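(* Let $\mathbb{F}_q$ be a finite field of order $q$ and let $n \geq 2$. For $f \in \mathbb{F}_q[t_1,\ldots,t_{n-1}]$ of degree $d \geq 1$, let \[ X_f := \{ (x,f(x)) \mid x \in \mathbb{F}_q^{n-1}\} \subseteq \mathbb{F}_q^n \] be the graph of the associated function $\mathbb{F}_q^{n-1} \to \mathbb{F}_q$. Then: a) We have $\underline{\omega}(X_f) \geq \frac{(n-1)(q-1)}{d}$. b) If $\underline{\omega}(X_f) = \frac{(n-1)(q-1)}{d}$ then $d \mid (n-1)(q-1)$. c) If $n-1 \mid d$ and $d \mid (n-1)(q-1)$, and the only monomial of degree $d$ in the support of $f$ is $t_1^{\frac{d}{n-1}} \cdots t_{n-1}^{\frac{d}{n-1}}$, then $\underline{\omega}(X_f) = \frac{(n-1)(q-1)}{d}$. d) If $n = 2$, then $\underline{\omega}(X_f) = \frac{q-1}{d}$ if and only if $d \mid q-1$.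
   Context: Here $\mathbb{N}$ is the set of non-negative integers. For a field $F$ of positive characteristic, a finite nonempty subset $X \subseteq F^n$, and $\underline{k} = (k_1,\ldots,k_n) \in \mathbb{N}^n$, put $|\underline{k}| := k_1+\ldots+k_n$ and \[ \pi_{\underline{k}}(X) := \sum_{(x_1,\ldots,x_n) \in X} x_1^{k_1}\cdots x_n^{k_n} \in F \] (with $x^0 = 1$ for all $x \in F$). Define $\underline{\omega}(X) := \inf\{ |\underline{k}| \mid \underline{k} \in \mathbb{N}^n,\ \pi_{\underline{k}}(X) \neq 0\}$. The support of a polynomial is the set of monomials occurring in it with nonzero coefficient. *)

theory Defs
  imports
    "HOL-Computational_Algebra.Primes"
    "HOL-Library.Cardinality"
    "HOL-Library.FuncSet"
    "HOL-Library.Poly_Mapping"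
    Complex_Main
begin

text \<open>
  The space \<open>F\<^sup>n\<close> is rendered as the extensional function space \<open>{..<n} \<rightarrow>\<^sub>E UNIV\<close>; the coordinates
  \<open>x\<^sub>1, \<dots>, x\<^sub>n\<close> of a point \<open>x\<close> are \<open>x 0, \<dots>, x (n - 1)\<close>.
\<close>

definition affine_space :: "nat \<Rightarrow> (nat \<Rightarrow> 'a) set"
  where "affine_space n = ({..<n} \<rightarrow>\<^sub>E UNIV)"

definition power_sum :: "nat \<Rightarrow> (nat \<Rightarrow> nat) \<Rightarrow> (nat \<Rightarrow> 'a) set \<Rightarrow> 'a::field_prime_char"
  where "power_sum n k X = (\<Sum>x\<in>X. \<Prod>i<n. x i ^ k i)"

text \<open>
  An exponent vector is any function \<open>k :: nat \<Rightarrow> nat\<close>; only its values below \<open>n\<close> matter.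
  The infimum is taken in the natural numbers, where \<open>Inf {} = 0\<close>; the lemma
  \<open>ex_power_sum_nonzero\<close> below shows that for finite nonempty \<open>X\<close> the set is never empty.
\<close>

definition omega :: "nat \<Rightarrow> (nat \<Rightarrow> 'a::field_prime_char) set \<Rightarrow> nat"
  where "omega n X = Inf {\<Sum>i<n. k i | k. power_sum n k X \<noteq> 0}"

lemma ex_power_sum_nonzero:
  fixes X :: "(nat \<Rightarrow> 'a::field_prime_char) set"
  assumes fin: "finite X" and ne: "X \<noteq> {}" and sub: "X \<subseteq> affine_space n"
  shows "\<exists>k. power_sum n k X \<noteq> 0"
proof (rule ccontr)
  assume "\<not> ?thesis"
  then have vanish: "(\<Sum>x\<in>X. \<Prod>i<n. x i ^ k i) = 0" for k
    by (simp add: power_sum_def)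
  obtain a where a: "a \<in> X" using ne by blast
  have "\<exists>g. (\<forall>k. (\<Sum>x\<in>X. (\<Prod>i<n. x i ^ k i) * g x) = 0) \<and> g a \<noteq> 0 \<and> (\<forall>b\<in>B. g b = 0)"
    if "finite B" "B \<subseteq> X - {a}" for B
    using that
  proof (induction B rule: finite_induct)
    case empty
    show ?case by (rule exI[of _ "\<lambda>_. 1"]) (simp add: vanish)
  next
    case (insert b B)
    then obtain g where g: "\<And>k. (\<Sum>x\<in>X. (\<Prod>i<n. x i ^ k i) * g x) = 0"
      "g a \<noteq> 0" "\<forall>b\<in>B. g b = 0" by auto
    have "\<exists>j<n. a j \<noteq> b j"
    proof (rule ccontr)
      assume "\<not> ?thesis"
      then have "a = b"
        using a insert.prems sub unfolding affine_space_def
        by (intro PiE_ext[of a "{..<n}" "\<lambda>_. UNIV" b]) auto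
      then show False using insert.prems by auto
    qed
    then obtain j where j: "j < n" "a j \<noteq> b j" by blast
    have shift: "(\<Prod>i<n. x i ^ (k(j := Suc (k j))) i) = (\<Prod>i<n. x i ^ k i) * x j"
      for x :: "nat \<Rightarrow> 'a" and k
      using j(1) by (simp add: prod.remove[of "{..<n}" j] algebra_simps)
    have "(\<Sum>x\<in>X. (\<Prod>i<n. x i ^ k i) * ((x j - b j) * g x)) = 0" for k
    proof -
      have "(\<Sum>x\<in>X. (\<Prod>i<n. x i ^ k i) * ((x j - b j) * g x)) =
          (\<Sum>x\<in>X. (\<Prod>i<n. x i ^ (k(j := Suc (k j))) i) * g x)
          - b j * (\<Sum>x\<in>X. (\<Prod>i<n. x i ^ k i) * g x)"
        unfolding shift sum_distrib_left sum_subtractf[symmetric]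
        by (intro sum.cong) (auto simp: algebra_simps)
      then show ?thesis by (simp add: g(1))
    qed
    then show ?case
      using g(2,3) j by (intro exI[of _ "\<lambda>x. (x j - b j) * g x"]) auto
  qed
  from this[of "X - {a}"] fin obtain g
    where g: "\<And>k. (\<Sum>x\<in>X. (\<Prod>i<n. x i ^ k i) * g x) = 0" "g a \<noteq> 0"
      "\<forall>b\<in>X - {a}. g b = 0" by auto
  have "(\<Sum>x\<in>X. g x) = g a"
    using g(3) fin a by (simp add: sum.remove[of X a])
  with g(1)[of "\<lambda>_. 0"] g(2) show False by simp
qed

text \<open>
  A multivariate polynomial in variables \<open>t\<^sub>0, t\<^sub>1, \<dots>\<close> is a finitely supported function from
  monomials (finitely supported exponent vectors) to coefficients;
  \<open>Poly_Mapping.keys f\<close> is the support of \<open>f\<close>. The variables are indexed from 0, like the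
  coordinates of points.
\<close>

type_synonym monomial = "nat \<Rightarrow>\<^sub>0 nat"
type_synonym 'a mpoly = "monomial \<Rightarrow>\<^sub>0 'a"

definition polys_in :: "nat \<Rightarrow> 'a::zero mpoly set"
  where "polys_in m = {f. \<forall>u\<in>Poly_Mapping.keys f. Poly_Mapping.keys u \<subseteq> {..<m}}"

definition monomial_degree :: "monomial \<Rightarrow> nat"
  where "monomial_degree u = (\<Sum>i\<in>Poly_Mapping.keys u. Poly_Mapping.lookup u i)"

definition total_degree :: "'a::zero mpoly \<Rightarrow> nat"
  where "total_degree f = Max (insert 0 (monomial_degree ` Poly_Mapping.keys f))"

definition eval_mpoly :: "'a::comm_semiring_1 mpoly \<Rightarrow> (nat \<Rightarrow> 'a) \<Rightarrow> 'a"
  where "eval_mpoly f x =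
    (\<Sum>u\<in>Poly_Mapping.keys f.
      Poly_Mapping.lookup f u * (\<Prod>i\<in>Poly_Mapping.keys u. x i ^ Poly_Mapping.lookup u i))"

text \<open>The point \<open>(x, f(x))\<close> of \<open>F\<^sup>n\<close> arises from \<open>x \<in> F\<^bsup>n-1\<^esup>\<close> by setting the last coordinate.\<close>

definition poly_graph :: "nat \<Rightarrow> 'a::comm_semiring_1 mpoly \<Rightarrow> (nat \<Rightarrow> 'a) set"
  where "poly_graph n f = {x(n - 1 := eval_mpoly f x) | x. x \<in> affine_space (n - 1)}"

end

theory Submission
  imports Defs "HOL-Computational_Algebra.Polynomial"
begin

text \<open>
  Expanding \<open>f(x)\<^bsup>K\<^esup>\<close> over all choices of one monomial per factor turns a power sum of the graph
  into a linear combination of products of \<open>n - 1\<close> one-variable power sums \<open>\<Sum>y. y\<^bsup>a\<^esup>\<close> over the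
  field. Such a sum vanishes for \<open>a < q - 1\<close>, so a product can be nonzero only if its total exponent
  is at least \<open>(n - 1) (q - 1)\<close>, whereas it is at most \<open>d \<bar>k\<bar>\<close>: this is the lower bound. For
  c) take \<open>k = (0, \<dots>, 0, (n - 1) (q - 1) / d)\<close>: only the choice of the top monomial in every factor
  attains the critical total exponent, and its contribution is a power of the leading coefficient
  times \<open>(-1)\<^bsup>n-1\<^esup>\<close>.
\<close>

section \<open>Power sums over a finite field\<close>

lemma power_card_minus_one_eq_one:
  fixes x :: "'a::finite_field"
  assumes "x \<noteq> 0"
  shows "x ^ (CARD('a) - 1) = 1"
proof -
  have "x * x ^ (CARD('a) - 1) = x * 1"
    using finite_field_power_card_eq_same[of x] zero_less_card_finite[where 'a='a]
    by (cases "CARD('a)") auto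
  with assms show ?thesis by simp
qed

lemma card_field_ge_2: "CARD('a::finite_field) \<ge> 2"
proof -
  have "card {0, 1 :: 'a} \<le> CARD('a)" by (rule card_mono) auto
  then show ?thesis by simp
qed

text \<open>Translation by 1 permutes the field, so the sum of all elements equals itself plus q
  times 1; cancel.\<close>

lemma of_nat_card_field: "of_nat CARD('a) = (0 :: 'a::finite_field)"
proof -
  have "(\<Sum>y\<in>UNIV. y) = (\<Sum>y\<in>UNIV. y + 1 :: 'a)"
    by (rule sum.reindex_bij_witness[of _ "\<lambda>y. y + 1" "\<lambda>y. y - 1"]) auto
  then show ?thesis by (simp add: sum.distrib)
qed

text \<open>The substitution y -> z y permutes the field and multiplies the sum by
  \<open>z ^ a\<close>, so any nonzero z with \<open>z ^ a \<noteq> 1\<close> forces the sum to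
  vanish.\<close>

lemma sum_powers_field_eq_0:
  assumes "a < CARD('a) - 1"
  shows "(\<Sum>y\<in>UNIV. y ^ a) = (0 :: 'a::finite_field)"
proof (cases "a = 0")
  case True
  \<comment> \<open>With \<open>0 ^ 0 = 1\<close> the sum is q times 1.\<close>
  then show ?thesis by (simp add: of_nat_card_field)
next
  case False
  \<comment> \<open>Otherwise t^a - 1 would have all q - 1 nonzero elements as roots, although its
    degree a is smaller.\<close>
  have "\<exists>z::'a. z \<noteq> 0 \<and> z ^ a \<noteq> 1"
  proof (rule ccontr)
    assume "\<not> ?thesis"
    then have roots: "UNIV - {0} \<subseteq> {z::'a. poly (monom 1 a + [:-1:]) z = 0}"
      by (auto simp: poly_monom)
    have deg: "degree (monom 1 a + [:-1:] :: 'a poly) = a"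
      using False by (simp add: degree_monom_eq degree_add_eq_left)
    with False have "monom 1 a + [:-1:] \<noteq> (0 :: 'a poly)" by auto
    then have "card {z::'a. poly (monom 1 a + [:-1:]) z = 0} \<le> a"
      using card_poly_roots_bound deg by metis
    moreover have "CARD('a) - 1 \<le> card {z::'a. poly (monom 1 a + [:-1:]) z = 0}"
      using card_mono[OF _ roots] by (simp add: card_Diff_singleton)
    ultimately show False using assms by simp
  qed
  then obtain z :: 'a where z: "z \<noteq> 0" "z ^ a \<noteq> 1" by blast
  have "(\<Sum>y\<in>UNIV. y ^ a) = (\<Sum>y\<in>UNIV. (z * y) ^ a)"
    using z(1) by (intro sum.reindex_bij_witness[of _ "\<lambda>y. z * y" "\<lambda>y. y / z"]) auto
  also have "\<dots> = z ^ a * (\<Sum>y\<in>UNIV. y ^ a)"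
    by (simp add: power_mult_distrib sum_distrib_left)
  finally show ?thesis using z(2) by simp
qed

text \<open>Each nonzero y contributes 1 and y = 0 contributes 0, the exponent being positive; this
  leaves q - 1, which is -1 in the field.\<close>

lemma sum_powers_field_card_minus_one:
  "(\<Sum>y\<in>UNIV. y ^ (CARD('a) - 1)) = (-1 :: 'a::finite_field)"
proof -
  have "(\<Sum>y\<in>UNIV. y ^ (CARD('a) - 1)) = (\<Sum>y\<in>UNIV - {0::'a}. y ^ (CARD('a) - 1))"
    using card_field_ge_2[where 'a='a] by (intro sum.mono_neutral_right) auto
  also have "\<dots> = of_nat (CARD('a) - 1)"
    by (simp add: power_card_minus_one_eq_one card_Diff_singleton del: One_nat_def)
  also have "\<dots> = -1"
    using card_field_ge_2[where 'a='a] by (simp add: of_nat_diff of_nat_card_field)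
  finally show ?thesis .
qed

text \<open>By pigeonhole some exponent lies below q - 1, and its factor vanishes.\<close>

lemma prod_sum_powers_field_eq_0:
  fixes a :: "nat \<Rightarrow> nat"
  assumes "(\<Sum>i<m. a i) < m * (CARD('a) - 1)"
  shows "(\<Prod>i<m. \<Sum>y\<in>UNIV. y ^ a i) = (0 :: 'a::finite_field)"
proof -
  have "\<exists>i<m. a i < CARD('a) - 1"
  proof (rule ccontr)
    assume "\<not> ?thesis"
    then have "(\<Sum>i<m. CARD('a) - 1) \<le> (\<Sum>i<m. a i)"
      by (intro sum_mono) (metis lessThan_iff not_less)
    with assms show False by simp
  qed
  then obtain i where i: "i < m" "a i < CARD('a) - 1" by blast
  have "(\<Sum>y\<in>UNIV. y ^ a i) = (0 :: 'a)" by (rule sum_powers_field_eq_0[OF i(2)])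
  with i(1) show ?thesis by (intro prod_zero) auto
qed

section \<open>Degrees of monomials and powers of polynomial values\<close>

lemma monomial_degree_eq_sum:
  "Poly_Mapping.keys u \<subseteq> {..<m} \<Longrightarrow> monomial_degree u = (\<Sum>i<m. Poly_Mapping.lookup u i)"
  unfolding monomial_degree_def by (rule sum.mono_neutral_left) (auto simp: in_keys_iff)

lemma monomial_degree_le_total_degree:
  "u \<in> Poly_Mapping.keys f \<Longrightarrow> monomial_degree u \<le> total_degree f"
  unfolding total_degree_def by (rule Max_ge) auto

text \<open>The 0 inserted into the maximum is a default that need not come from a monomial;
  positivity excludes it.\<close>

lemma total_degree_attained:
  assumes "total_degree f > 0"
  obtains u where "u \<in> Poly_Mapping.keys f" "monomial_degree u = total_degree f"
proof -
  have "total_degree f \<in> insert 0 (monomial_degree ` Poly_Mapping.keys f)"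
    unfolding total_degree_def by (rule Max_in) auto
  with assms show ?thesis by (auto intro: that)
qed

text \<open>Distributivity: \<open>g\<close> records which monomial is taken from each of the K
  factors, so no multinomial coefficients appear.\<close>

lemma eval_mpoly_power:
  assumes "f \<in> polys_in m"
  shows "eval_mpoly f x ^ K =
    (\<Sum>g\<in>{..<K} \<rightarrow>\<^sub>E Poly_Mapping.keys f.
      (\<Prod>j<K. Poly_Mapping.lookup f (g j)) * (\<Prod>i<m. x i ^ (\<Sum>j<K. Poly_Mapping.lookup (g j) i)))"
proof -
  have mon: "(\<Prod>i\<in>Poly_Mapping.keys u. x i ^ Poly_Mapping.lookup u i)
      = (\<Prod>i<m. x i ^ Poly_Mapping.lookup u i)" if "u \<in> Poly_Mapping.keys f" for u
    using assms that unfolding polys_in_def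
    by (intro prod.mono_neutral_left) (auto simp: in_keys_iff)
  have "eval_mpoly f x ^ K = (\<Prod>j<K. \<Sum>u\<in>Poly_Mapping.keys f.
      Poly_Mapping.lookup f u * (\<Prod>i<m. x i ^ Poly_Mapping.lookup u i))"
    by (simp add: eval_mpoly_def mon)
  also have "\<dots> = (\<Sum>g\<in>{..<K} \<rightarrow>\<^sub>E Poly_Mapping.keys f.
      \<Prod>j<K. Poly_Mapping.lookup f (g j) * (\<Prod>i<m. x i ^ Poly_Mapping.lookup (g j) i))"
    by (rule prod_sum_PiE) auto
  also have "\<dots> = (\<Sum>g\<in>{..<K} \<rightarrow>\<^sub>E Poly_Mapping.keys f.
      (\<Prod>j<K. Poly_Mapping.lookup f (g j)) * (\<Prod>i<m. x i ^ (\<Sum>j<K. Poly_Mapping.lookup (g j) i)))"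
    by (intro sum.cong refl)
      (simp add: prod.distrib power_sum prod.swap[of _ "{..<m}"])
  finally show ?thesis .
qed

section \<open>Power sums of the graph\<close>

lemma poly_graph_eq_image:
  "poly_graph (Suc m) f = (\<lambda>x. x(m := eval_mpoly f x)) ` affine_space m"
  by (auto simp: poly_graph_def)

text \<open>Points of \<open>affine_space m\<close> are extensional, hence determined by the
  coordinates below m, which the update leaves alone.\<close>

lemma inj_on_graph_point:
  "inj_on (\<lambda>x. x(m := h x)) (affine_space m :: (nat \<Rightarrow> 'a) set)"
proof (rule inj_onI)
  fix x y :: "nat \<Rightarrow> 'a"
  assume xy: "x \<in> affine_space m" "y \<in> affine_space m" "x(m := h x) = y(m := h y)"
  then have "x i = y i" if "i < m" for i
    using that by (metis fun_upd_other nat_neq_iff)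
  with xy show "x = y"
    unfolding affine_space_def by (intro PiE_ext[of x _ _ y]) auto
qed

lemma power_sum_poly_graph:
  fixes f :: "'a::finite_field mpoly"
  assumes f: "f \<in> polys_in m"
  shows "power_sum (Suc m) k (poly_graph (Suc m) f) =
    (\<Sum>g\<in>{..<k m} \<rightarrow>\<^sub>E Poly_Mapping.keys f. (\<Prod>j<k m. Poly_Mapping.lookup f (g j)) *
      (\<Prod>i<m. \<Sum>y\<in>UNIV. y ^ (k i + (\<Sum>j<k m. Poly_Mapping.lookup (g j) i))))"
proof -
  let ?G = "{..<k m} \<rightarrow>\<^sub>E Poly_Mapping.keys f"
  let ?c = "\<lambda>g. \<Prod>j<k m. Poly_Mapping.lookup f (g j)"
  let ?e = "\<lambda>g i. k i + (\<Sum>j<k m. Poly_Mapping.lookup (g j) i)"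
  have "power_sum (Suc m) k (poly_graph (Suc m) f) =
      (\<Sum>x\<in>affine_space m. (\<Prod>i<m. x i ^ k i) * eval_mpoly f x ^ k m)"
    by (simp add: power_sum_def poly_graph_eq_image sum.reindex inj_on_graph_point)
  also have "\<dots> = (\<Sum>x\<in>affine_space m. \<Sum>g\<in>?G. ?c g * (\<Prod>i<m. x i ^ ?e g i))"
    by (simp add: eval_mpoly_power[OF f] sum_distrib_left power_add prod.distrib mult_ac)
  also have "\<dots> = (\<Sum>g\<in>?G. ?c g * (\<Sum>x\<in>affine_space m. \<Prod>i<m. x i ^ ?e g i))"
    by (subst sum.swap) (simp add: sum_distrib_left)
  \<comment> \<open>The coordinates of a point vary independently, so the sum over the whole space
    factors.\<close>
  also have "\<dots> = (\<Sum>g\<in>?G. ?c g * (\<Prod>i<m. \<Sum>y\<in>UNIV. y ^ ?e g i))"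
    by (simp add: affine_space_def prod_sum_PiE)
  finally show ?thesis .
qed

lemma sum_exponents:
  assumes "f \<in> polys_in m" "g \<in> {..<K} \<rightarrow>\<^sub>E Poly_Mapping.keys f"
  shows "(\<Sum>i<m. \<Sum>j<K. Poly_Mapping.lookup (g j) i) = (\<Sum>j<K. monomial_degree (g j))"
proof -
  have "(\<Sum>i<m. Poly_Mapping.lookup (g j) i) = monomial_degree (g j)" if "j < K" for j
    using assms that monomial_degree_eq_sum[of "g j" m] by (force simp: polys_in_def PiE_iff)
  then show ?thesis by (subst sum.swap) simp
qed

text \<open>Each factor of the expansion adds at most \<open>total_degree f\<close> to the total
  exponent, so every choice \<open>g\<close> stays below the threshold for a nonzero
  product.\<close>

lemma power_sum_poly_graph_eq_0:
  fixes f :: "'a::finite_field mpoly"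
  assumes f: "f \<in> polys_in m"
    and lt: "(\<Sum>i<m. k i) + k m * total_degree f < m * (CARD('a) - 1)"
  shows "power_sum (Suc m) k (poly_graph (Suc m) f) = 0"
  unfolding power_sum_poly_graph[OF f]
proof (rule sum.neutral, rule ballI)
  fix g assume g: "g \<in> {..<k m} \<rightarrow>\<^sub>E Poly_Mapping.keys f"
  have "(\<Sum>j<k m. monomial_degree (g j)) \<le> (\<Sum>j<k m. total_degree f)"
    using g by (intro sum_mono monomial_degree_le_total_degree) auto
  then have "(\<Sum>i<m. k i + (\<Sum>j<k m. Poly_Mapping.lookup (g j) i)) < m * (CARD('a) - 1)"
    using lt by (simp add: sum.distrib sum_exponents[OF f g])
  from prod_sum_powers_field_eq_0[OF this]
  show "(\<Prod>j<k m. Poly_Mapping.lookup f (g j)) *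
      (\<Prod>i<m. \<Sum>y\<in>UNIV. y ^ (k i + (\<Sum>j<k m. Poly_Mapping.lookup (g j) i))) = 0"
    by simp
qed

section \<open>Lower bound for \<open>omega\<close> and cases of equality\<close>

lemma omega_attained:
  fixes f :: "'a::finite_field mpoly"
  obtains k where "power_sum (Suc m) k (poly_graph (Suc m) f) \<noteq> 0"
    "omega (Suc m) (poly_graph (Suc m) f) = (\<Sum>i<Suc m. k i)"
proof -
  let ?X = "poly_graph (Suc m) f"
  have "finite (affine_space m :: (nat \<Rightarrow> 'a) set)"
    unfolding affine_space_def by (intro finite_PiE) auto
  then have "finite ?X" by (simp add: poly_graph_eq_image)
  moreover have "?X \<noteq> {}"
    by (simp add: poly_graph_eq_image affine_space_def PiE_eq_empty_iff)
  moreover have "?X \<subseteq> affine_space (Suc m)"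
    by (auto simp: poly_graph_def affine_space_def PiE_def extensional_def)
  ultimately obtain k where "power_sum (Suc m) k ?X \<noteq> 0"
    using ex_power_sum_nonzero by blast
  then have "{\<Sum>i<Suc m. k i | k. power_sum (Suc m) k ?X \<noteq> 0} \<noteq> {}" by blast
  \<comment> \<open>Nonemptiness rules out the default \<open>Inf {} = 0\<close>, so the infimum is
    a minimum.\<close>
  then have "omega (Suc m) ?X \<in> {\<Sum>i<Suc m. k i | k. power_sum (Suc m) k ?X \<noteq> 0}"
    unfolding omega_def by (rule Inf_nat_def1)
  then show ?thesis using that by blast
qed

lemma omega_poly_graph_ge:
  fixes f :: "'a::finite_field mpoly"
  assumes f: "f \<in> polys_in m" and d: "total_degree f \<ge> 1"
  shows "m * (CARD('a) - 1) \<le> omega (Suc m) (poly_graph (Suc m) f) * total_degree f"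
proof -
  obtain k where k: "power_sum (Suc m) k (poly_graph (Suc m) f) \<noteq> 0"
    "omega (Suc m) (poly_graph (Suc m) f) = (\<Sum>i<Suc m. k i)"
    by (rule omega_attained)
  have "m * (CARD('a) - 1) \<le> (\<Sum>i<m. k i) + k m * total_degree f"
    using power_sum_poly_graph_eq_0[OF f] k(1) by (metis not_le)
  \<comment> \<open>As the degree is at least 1, the first m exponents may also be multiplied by
    it.\<close>
  also have "\<dots> \<le> (\<Sum>i<Suc m. k i) * total_degree f"
    using d by (simp add: add_mult_distrib)
  finally show ?thesis by (simp add: k(2))
qed

lemma omega_poly_graph_eq:
  fixes f :: "'a::finite_field mpoly"
  assumes f: "f \<in> polys_in m" and d: "total_degree f = m * c" "c \<ge> 1" "m \<ge> 1"
    and dvd: "total_degree f dvd m * (CARD('a) - 1)"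
    and top: "{u \<in> Poly_Mapping.keys f. monomial_degree u = total_degree f}
      = {\<Sum>i<m. Poly_Mapping.single i c}"
  shows "omega (Suc m) (poly_graph (Suc m) f) * total_degree f = m * (CARD('a) - 1)"
proof -
  define u0 where "u0 = (\<Sum>i<m. Poly_Mapping.single i c)"
  have u0: "u0 \<in> Poly_Mapping.keys f"
    and uniq: "\<And>u. u \<in> Poly_Mapping.keys f \<Longrightarrow> monomial_degree u = total_degree f \<Longrightarrow> u = u0"
    using top unfolding u0_def by auto
  have lookup_u0: "Poly_Mapping.lookup u0 i = c" if "i < m" for i
    using that by (simp add: u0_def lookup_sum lookup_single when_def)
  obtain K where K: "m * (CARD('a) - 1) = total_degree f * K" using dvd by blast
  \<comment> \<open>Cancelling m: choosing the top monomial in all K factors gives every variable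
    exactly the critical exponent q - 1.\<close>
  then have Kc: "K * c = CARD('a) - 1" using d by (simp add: mult_ac)
  define k where "k = (\<lambda>i. if i = m then K else 0)"
  define g0 where "g0 = restrict (\<lambda>_. u0) {..<K}"
  let ?G = "{..<K} \<rightarrow>\<^sub>E Poly_Mapping.keys f"
  let ?t = "\<lambda>g. (\<Prod>j<K. Poly_Mapping.lookup f (g j)) *
      (\<Prod>i<m. \<Sum>y\<in>UNIV. y ^ (\<Sum>j<K. Poly_Mapping.lookup (g j) i))"
  have g0: "g0 \<in> ?G" using u0 by (auto simp: g0_def)
  have other: "?t g = 0" if g: "g \<in> ?G - {g0}" for g
  proof -
    \<comment> \<open>Some factor then uses a monomial of degree below the top, which pushes the
      total exponent strictly under m (q - 1).\<close>
    have "\<exists>j<K. g j \<noteq> u0"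
    proof (rule ccontr)
      assume "\<not> ?thesis"
      then have "g = g0" using g g0
        by (intro PiE_ext[of g "{..<K}" "\<lambda>_. Poly_Mapping.keys f" g0]) (auto simp: g0_def)
      with g show False by simp
    qed
    then obtain j where j: "j < K" "g j \<noteq> u0" by blast
    have le: "monomial_degree (g i) \<le> total_degree f" if "i < K" for i
      using g that by (intro monomial_degree_le_total_degree) auto
    have "g j \<in> Poly_Mapping.keys f" using g j by auto
    with uniq j le have "monomial_degree (g j) < total_degree f" by (metis le_neq_implies_less)
    with le j have "(\<Sum>j<K. monomial_degree (g j)) < (\<Sum>j<K. total_degree f)"
      by (intro sum_strict_mono_ex1) auto
    moreover have "(\<Sum>i<m. \<Sum>j<K. Poly_Mapping.lookup (g j) i) = (\<Sum>j<K. monomial_degree (g j))"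
      using g by (intro sum_exponents[OF f]) simp
    ultimately have "(\<Sum>i<m. \<Sum>j<K. Poly_Mapping.lookup (g j) i) < m * (CARD('a) - 1)"
      unfolding K by (simp add: mult.commute)
    from prod_sum_powers_field_eq_0[OF this] show ?thesis by simp
  qed
  have fin: "finite ?G" by (intro finite_PiE) auto
  have "power_sum (Suc m) k (poly_graph (Suc m) f) = (\<Sum>g\<in>?G. ?t g)"
    by (simp add: power_sum_poly_graph[OF f] k_def)
  also have "\<dots> = ?t g0"
    using other fin g0 by (subst sum.remove[OF fin g0]) (simp add: sum.neutral)
  \<comment> \<open>By \<open>Kc\<close> each of the m one-variable sums is the sum of all y^(q-1),
    that is, -1.\<close>
  also have "\<dots> = Poly_Mapping.lookup f u0 ^ K * (-1) ^ m"
    by (simp add: g0_def lookup_u0 Kc sum_powers_field_card_minus_one del: One_nat_def)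
  also have "\<dots> \<noteq> 0" using u0 by (simp add: in_keys_iff)
  finally have "(\<Sum>i<Suc m. k i) \<in> {\<Sum>i<Suc m. k i | k. power_sum (Suc m) k (poly_graph (Suc m) f) \<noteq> 0}"
    by blast
  from wellorder_Inf_le1[OF this] have "omega (Suc m) (poly_graph (Suc m) f) \<le> K"
    by (simp add: omega_def k_def)
  then have "omega (Suc m) (poly_graph (Suc m) f) * total_degree f \<le> m * (CARD('a) - 1)"
    unfolding K by simp
  moreover have "total_degree f \<ge> 1" using d by simp
  ultimately show ?thesis using omega_poly_graph_ge[OF f] by (metis le_antisym)
qed

text \<open>A monomial in one variable is determined by its degree, so the assumption on the top
  monomial in c) is automatic for n = 2.\<close>

lemma top_monomial_univariate:
  assumes f: "f \<in> polys_in 1" and d: "total_degree f \<ge> 1"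
  shows "{u \<in> Poly_Mapping.keys f. monomial_degree u = total_degree f}
    = {\<Sum>i<1. Poly_Mapping.single i (total_degree f)}"
proof -
  have eq: "u = Poly_Mapping.single 0 (total_degree f)"
    if "u \<in> Poly_Mapping.keys f" "monomial_degree u = total_degree f" for u
  proof (rule poly_mapping_eqI)
    have "Poly_Mapping.keys u \<subseteq> {..<1}" using f that by (auto simp: polys_in_def)
    with that monomial_degree_eq_sum[of u 1]
    show "Poly_Mapping.lookup u i = Poly_Mapping.lookup (Poly_Mapping.single 0 (total_degree f)) i" for i
      by (cases "i = 0") (auto simp: lookup_single when_def in_keys_iff subset_iff)
  qed
  obtain u where "u \<in> Poly_Mapping.keys f" "monomial_degree u = total_degree f"
    using total_degree_attained d by (metis One_nat_def Suc_le_eq)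
  with eq show ?thesis by auto
qed

theorem proposition3p10:
  fixes f :: "'a::finite_field mpoly" and n d q :: nat
  assumes q: "q = CARD('a)"
    and n: "n \<ge> 2"
    and f: "f \<in> polys_in (n - 1)"
    and deg: "total_degree f = d"
    and d: "d \<ge> 1"
  shows
    "(real (omega n (poly_graph n f)) \<ge> real ((n - 1) * (q - 1)) / real d) \<and>
     (real (omega n (poly_graph n f)) = real ((n - 1) * (q - 1)) / real d
        \<longrightarrow> d dvd (n - 1) * (q - 1)) \<and>
     ((n - 1) dvd d \<and> d dvd (n - 1) * (q - 1) \<and>
      {u \<in> Poly_Mapping.keys f. monomial_degree u = d} =
        {\<Sum>i<n - 1. Poly_Mapping.single i (d div (n - 1))}
        \<longrightarrow> real (omega n (poly_graph n f)) = real ((n - 1) * (q - 1)) / real d) \<and>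
     (n = 2 \<longrightarrow>
        (real (omega n (poly_graph n f)) = real (q - 1) / real d \<longleftrightarrow> d dvd q - 1))"
proof -
  define m where "m = n - 1"
  have m: "n = Suc m" "n - 1 = m" "m \<ge> 1" using n by (auto simp: m_def)
  let ?w = "omega n (poly_graph n f)"
  have fm: "f \<in> polys_in m" using f m by simp
  \<comment> \<open>Clearing denominators turns all equalities into statements about natural
    numbers.\<close>
  have quot: "real ?w = real N / real d \<longleftrightarrow> ?w * d = N" for N
    using d by (simp add: field_simps flip: of_nat_mult)
  have a: "m * (q - 1) \<le> ?w * d"
    using omega_poly_graph_ge[OF fm] deg d q m by simp
  then have ra: "real (m * (q - 1)) / real d \<le> real ?w"
    using d by (simp add: divide_le_eq flip: of_nat_mult)
  have c: "?w * d = m * (q - 1)" if "m dvd d" "d dvd m * (q - 1)"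
    "{u \<in> Poly_Mapping.keys f. monomial_degree u = d} = {\<Sum>i<m. Poly_Mapping.single i (d div m)}"
    using omega_poly_graph_eq[OF fm, of "d div m"] that deg d q m
    by (simp add: div_greater_zero_iff dvd_imp_le Suc_le_eq)
  \<comment> \<open>This is c) with m = 1, where m divides d trivially.\<close>
  have "?w * d = q - 1" if "n = 2" "d dvd q - 1"
    using c top_monomial_univariate[of f] fm that deg d m by (simp add: numeral_2_eq_2)
  then have e: "?w * d = q - 1 \<longleftrightarrow> d dvd q - 1" if "n = 2"
    using that by (metis dvd_triv_right)
  \<comment> \<open>The integer \<open>?w\<close> is itself the cofactor.\<close>
  have b: "d dvd m * (q - 1)" if "?w * d = m * (q - 1)"
    using that by (metis dvd_triv_right)
  show ?thesis
    unfolding m(2) quot by (intro conjI impI) (use ra b c e in \<open>simp_all only:\<close>)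
qed

end
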